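(* Let $(X_t)_{t\in\mathbb{Z}}$ be the CM3 process with parameter functions $a_i^{(j)}$ ($i\in\mathbb{Z}_+$, $j\in\mathbb{Z}$), and assume $\sum_{j\in\mathbb{Z}}\sum_{i\geqslant 0}\|a_i^{(j)}\|_\infty<\infty$. Then $(X_t)_{t\in\mathbb{Z}}$ satisfies the finite-cluster condition: there exists a sequence $(r_n)_{n\in\mathbb{N}}$ of positive integers with $r_n\to\infty$ and $r_n/n\to 0$ such that $$\lim_{m\to\infty}\limsup_{n\to\infty}P\Bigl(\max_{m\leqslant|t|\leqslant r_n}\|X_t\|_\infty>n\ \Big|\ \|X_0\|_\infty>n\Bigr)=0.$$
   Context: Fix an integer $q\geqslant 1$. $\mathbb{Z}_+=\{0,1,2,\ldots\}$. For $f:[0,1]^q\to\mathbb{R}$, $\|f\|_\infty=\sup_{x\in[0,1]^q}|f(x)|$. A unit-Fréchet random variable $Z$ satisfies $P(Z\leqslant z)=\exp(-1/z)$ for $z>0$. CM3 process: let $a_i^{(j)}:[0,1]^q\to(0,\infty)$ ($i\in\mathbb{Z}_+$, $j\in\mathbb{Z}$) be deterministic, strictly positive, continuous functions (the parameter functions) and let $Z_i^{(j)}$ ($i\in\mathbb{Z}$, $j\in\mathbb{Z}$) be independent unit-Fréchet random variables. The CM3 process is $X_t(x)=\sup_{j\in\mathbb{Z}}\sup_{i\geqslant0}(a_i^{(j)}(x)Z_{t-i}^{(j)})$, $x\in[0,1]^q$, $t\in\mathbb{Z}$. Under the summability assumption of the claim, each $X_t$ is (up to a null event) a random continuous function on $[0,1]^q$,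 and the process is stationary. In the finite-cluster condition, $m$ and $t$ are integers. *)

theory Defs
  imports "HOL-Probability.Probability"
begin

definition unit_cube :: "(real ^ 'q::finite) set" where
  "unit_cube = {x. \<forall>k. 0 \<le> x $ k \<and> x $ k \<le> 1}"

text \<open>Polymorphic in the codomain: on continuous real functions it is the usual (finite)
  sup norm, on extended-real functions it may be infinite.\<close>

definition sup_norm :: "(real ^ 'q::finite \<Rightarrow> 'b::{abs,Sup}) \<Rightarrow> 'b" where
  "sup_norm f = (SUP x\<in>unit_cube. \<bar>f x\<bar>)"

definition unit_frechet :: "'w measure \<Rightarrow> ('w \<Rightarrow> real) \<Rightarrow> bool" where
  "unit_frechet M Z \<longleftrightarrow>
     Z \<in> borel_measurable M \<and> (\<forall>z>0. \<P>(\<omega> in M. Z \<omega> \<le> z) = exp (- 1 / z))"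

text \<open>\<open>a i j\<close> and \<open>Z s j\<close> stand for the parameter function and the innovation with lower index
  \<open>i\<close>, respectively \<open>s\<close>, and upper index \<open>j\<close>. The suprema are taken in the extended reals because
  they are finite only up to a null event; a real-valued \<open>SUP\<close> of an unbounded family would be
  unspecified.\<close>

definition cm3 ::
  "(nat \<Rightarrow> int \<Rightarrow> real ^ 'q::finite \<Rightarrow> real) \<Rightarrow> (int \<Rightarrow> int \<Rightarrow> 'w \<Rightarrow> real) \<Rightarrow>
   int \<Rightarrow> 'w \<Rightarrow> real ^ 'q \<Rightarrow> ereal" where
  "cm3 a Z t \<omega> x = (SUP j. SUP i. ereal (a i j x * Z (t - int i) j \<omega>))"

text \<open>The supremum over \<open>t\<close> ranges over a finite set, so it is the maximum as soon as \<open>m \<le> r n\<close>;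
  over the empty set it is \<open>-\<infinity>\<close> and the event is empty. For fixed \<open>m\<close> that happens for finitely
  many \<open>n\<close> only, which does not affect the upper limit.\<close>

definition finite_cluster_condition ::
  "'w measure \<Rightarrow> (int \<Rightarrow> 'w \<Rightarrow> real ^ 'q::finite \<Rightarrow> ereal) \<Rightarrow> bool" where
  "finite_cluster_condition M X \<longleftrightarrow>
     (\<exists>r :: nat \<Rightarrow> nat.
        (\<forall>n. r n > 0) \<and>
        filterlim r at_top sequentially \<and>
        (\<lambda>n. real (r n) / real n) \<longlonglongrightarrow> 0 \<and>
        ((\<lambda>m::int. limsup (\<lambda>n. ereal
            \<P>(\<omega> in M. (SUP t\<in>{t. m \<le> \<bar>t\<bar> \<and> \<bar>t\<bar> \<le> int (r n)}. sup_norm (X t \<omega>)) > ereal (real n)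
               \<bar> sup_norm (X 0 \<omega>) > ereal (real n)))) \<longlongrightarrow> 0) at_top)"

end

theory Submission
  imports Defs "HOL-Real_Asymp.Real_Asymp"
begin

text \<open>
  Write \<open>c (j, i)\<close> for the sup norm of \<open>a i j\<close>. Because all parameter functions and, almost surely,
  all innovations are nonnegative, the norm of \<open>X\<^sub>t\<close> exceeds \<open>u\<close> exactly when a single
  scaled innovation does: \<open>c (j, i) * Z (t - i) j > u\<close> for some \<open>j\<close> and \<open>i\<close>. The whole problem is
  thus about a countable family of independent heavy-tailed variables with
  \<open>P (c * Z > u) = 1 - exp (- c / u) \<le> c / u\<close>.

  Suppose that \<open>X\<^sub>0\<close> and some \<open>X\<^sub>t\<close> with \<open>m \<le> \<bar>t\<bar> \<le> r\<close> both exceed \<open>n\<close>, and look at the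
  innovations responsible. If they are different, independence makes the probability of this at most
  \<open>(2 r + 1) (C / n)\<^sup>2\<close>, where \<open>C\<close> is the sum of \<open>c\<close>. If they are the same innovation, it is weighted
  by \<open>c (j, i)\<close> in \<open>X\<^sub>0\<close> and by \<open>c (j, k)\<close> with \<open>\<bar>k - i\<bar> = \<bar>t\<bar> \<ge> m\<close> in \<open>X\<^sub>t\<close>, so that even its smaller
  multiple exceeds \<open>n\<close>; summing over \<open>(j, i)\<close>, this has probability at most \<open>D m / n\<close>, where \<open>D m\<close>
  is the sum of the minima of \<open>c (j, i)\<close> and \<open>sup {c (j, k) | \<bar>k - i\<bar> \<ge> m}\<close> (lemma
  \<open>joint_exceedance_le\<close>). Treating all times \<open>t\<close> at once matters for this term: a union
  bound over \<open>t\<close> would replace the supremum over \<open>k\<close> by a sum, and the resulting double series can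
  diverge although \<open>c\<close> is summable.

  The probability of the conditioning event is at least \<open>1 - exp (- c (0, 0) / n)\<close>, which is of order
  \<open>1 / n\<close>. Hence, as soon as \<open>r n / n\<close> tends to \<open>0\<close>, the upper limit over \<open>n\<close> of the conditional
  probability is at most \<open>D m / c (0, 0)\<close>; here \<open>r n = \<lfloor>sqrt n\<rfloor> + 1\<close>. Finally \<open>D m\<close> tends to \<open>0\<close> by
  dominated convergence with majorant \<open>c\<close>
  (lemma \<open>integral_distant_overlap_tendsto_0\<close>).
\<close>

section \<open>Countable sums as integrals over the counting measure\<close>

lemma emeasure_UN_le_nn_integral_count_space:
  fixes A :: "'i::countable \<Rightarrow> 'a set"
  assumes A [measurable]: "\<And>i. A i \<in> sets M"
  shows "emeasure M (\<Union>i. A i) \<le> (\<integral>\<^sup>+i. emeasure M (A i) \<partial>count_space UNIV)"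
proof -
  have "emeasure M (\<Union>i. A i) = (\<integral>\<^sup>+x. indicator (\<Union>i. A i) x \<partial>M)"
    by (simp add: sets.countable_UN')
  also have "\<dots> \<le> (\<integral>\<^sup>+x. (\<integral>\<^sup>+i. indicator (A i) x \<partial>count_space UNIV) \<partial>M)"
  proof (rule nn_integral_mono)
    fix x
    show "indicator (\<Union>i. A i) x \<le> (\<integral>\<^sup>+i. indicator (A i) x \<partial>count_space UNIV :: ennreal)"
    proof (cases "\<exists>i. x \<in> A i")
      case True
      then obtain i where "x \<in> A i" by blast
      then have "1 \<le> (indicator (A i) x :: ennreal)" by simp
      also have "\<dots> \<le> (\<integral>\<^sup>+i. indicator (A i) x \<partial>count_space UNIV)"
        by (rule nn_integral_ge_point) simp
      finally show ?thesis using True by (simp add: indicator_def)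
    qed simp
  qed
  also have "\<dots> = (\<integral>\<^sup>+i. emeasure M (A i) \<partial>count_space UNIV)"
    by (subst nn_integral_count_space_nn_integral) auto
  finally show ?thesis .
qed

lemma integrable_count_space_iff_summable_on:
  fixes f :: "'i \<Rightarrow> real"
  shows "integrable (count_space A) f \<longleftrightarrow> f summable_on A"
  by (simp only: summable_on_iff_abs_summable_on_real[of f A] abs_summable_equivalent abs_summable_on_def)

section \<open>Frechet tails and pairwise independence\<close>

lemma (in prob_space) unit_frechet_tail:
  assumes "unit_frechet M Z" "c > 0" "u > 0"
  shows "prob {\<omega> \<in> space M. c * Z \<omega> > u} = 1 - exp (- c / u)"
proof -
  have [measurable]: "Z \<in> borel_measurable M"
    using assms(1) by (simp add: unit_frechet_def)
  have "{\<omega> \<in> space M. c * Z \<omega> > u} = space M - {\<omega> \<in> space M. Z \<omega> \<le> u / c}"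
    using assms by (auto simp: field_simps not_le)
  then have "prob {\<omega> \<in> space M. c * Z \<omega> > u} = 1 - prob {\<omega> \<in> space M. Z \<omega> \<le> u / c}"
    by (simp add: prob_compl)
  also have "prob {\<omega> \<in> space M. Z \<omega> \<le> u / c} = exp (- 1 / (u / c))"
    using assms by (simp add: unit_frechet_def)
  finally show ?thesis by simp
qed

lemma (in prob_space) unit_frechet_tail_le:
  assumes "unit_frechet M Z" "c > 0" "u > 0"
  shows "prob {\<omega> \<in> space M. c * Z \<omega> > u} \<le> c / u"
  using unit_frechet_tail[OF assms] exp_ge_add_one_self[of "- c / u"] by simp

text \<open>Only the values of the distribution function at positive arguments are given; they decide the
  sign because \<open>exp (- 1 / z)\<close> vanishes as \<open>z\<close> decreases to \<open>0\<close>.\<close>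

lemma (in prob_space) unit_frechet_AE_nonneg:
  assumes "unit_frechet M Z"
  shows "AE \<omega> in M. Z \<omega> \<ge> 0"
proof -
  have [measurable]: "Z \<in> borel_measurable M"
    using assms by (simp add: unit_frechet_def)
  have "prob {\<omega> \<in> space M. Z \<omega> < 0} \<le> exp (- 1 / z)" if "z > 0" for z
  proof -
    have "prob {\<omega> \<in> space M. Z \<omega> < 0} \<le> prob {\<omega> \<in> space M. Z \<omega> \<le> z}"
      using that by (intro finite_measure_mono) auto
    then show ?thesis using that assms by (simp add: unit_frechet_def)
  qed
  then have "eventually (\<lambda>z. prob {\<omega> \<in> space M. Z \<omega> < 0} \<le> exp (- 1 / z)) (at_right 0)"
    by (simp add: eventually_at_right_less eventually_mono[OF eventually_at_right_less])
  moreover have "((\<lambda>z::real. exp (- 1 / z)) \<longlongrightarrow> 0) (at_right 0)"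
    by real_asymp
  ultimately have "prob {\<omega> \<in> space M. Z \<omega> < 0} \<le> 0"
    by (intro tendsto_lowerbound) auto
  then have "prob {\<omega> \<in> space M. Z \<omega> < 0} = 0"
    by (simp add: measure_le_0_iff)
  then show ?thesis
    by (subst AE_iff_measurable[OF _ refl]) (auto simp: emeasure_eq_measure not_le)
qed

lemma (in prob_space) indep_vars_prob_pair:
  assumes ind: "indep_vars M' X UNIV" and "k \<noteq> l"
    and A: "A \<in> sets (M' k)" and B: "B \<in> sets (M' l)"
  shows "prob (X k -` A \<inter> X l -` B \<inter> space M) =
    prob (X k -` A \<inter> space M) * prob (X l -` B \<inter> space M)"
proof -
  have "prob (\<Inter>i\<in>{k, l}. X i -` (if i = k then A else B) \<inter> space M) =
      (\<Prod>i\<in>{k, l}. prob (X i -` (if i = k then A else B) \<inter> space M))"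
    using assms by (intro indep_varsD[OF ind]) auto
  moreover have "(\<Inter>i\<in>{k, l}. X i -` (if i = k then A else B) \<inter> space M) =
      X k -` A \<inter> X l -` B \<inter> space M"
    using \<open>k \<noteq> l\<close> by auto
  ultimately show ?thesis using \<open>k \<noteq> l\<close> by simp
qed

section \<open>Exceedances of the CM3 process and of single innovations\<close>

lemma unit_cube_eq_cbox: "unit_cube = cbox 0 (1 :: real ^ 'q::finite)"
  by (auto simp: unit_cube_def mem_box_cart)

lemma compact_unit_cube: "compact (unit_cube :: (real ^ 'q::finite) set)"
  by (simp add: unit_cube_eq_cbox)

lemma zero_in_unit_cube: "(0 :: real ^ 'q::finite) \<in> unit_cube"
  by (simp add: unit_cube_def)

lemma sup_norm_attained:
  fixes f :: "real ^ 'q::finite \<Rightarrow> real"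
  assumes "continuous_on unit_cube f"
  obtains x where "x \<in> unit_cube" "sup_norm f = \<bar>f x\<bar>" "\<And>y. y \<in> unit_cube \<Longrightarrow> \<bar>f y\<bar> \<le> \<bar>f x\<bar>"
proof -
  have "continuous_on unit_cube (\<lambda>x. \<bar>f x\<bar>)"
    using assms by (intro continuous_intros)
  then obtain x where x: "x \<in> unit_cube" "\<And>y. y \<in> unit_cube \<Longrightarrow> \<bar>f y\<bar> \<le> \<bar>f x\<bar>"
    using continuous_attains_sup[OF compact_unit_cube] zero_in_unit_cube by blast
  then have "sup_norm f = \<bar>f x\<bar>"
    unfolding sup_norm_def by (intro cSup_eq_maximum) auto
  with x that show ?thesis by blast
qed

text \<open>The two lemmas below exchange the supremum over the cube with the suprema over \<open>i\<close> and \<open>j\<close>. In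
  this direction it suffices to evaluate the process where \<open>a i j\<close> attains its maximum, whatever the
  signs of the innovations.\<close>

lemma single_term_exceeds_imp_sup_norm_cm3_exceeds:
  fixes a :: "nat \<Rightarrow> int \<Rightarrow> real ^ 'q::finite \<Rightarrow> real"
  assumes cont: "continuous_on unit_cube (a i j)"
    and pos: "\<And>x. x \<in> unit_cube \<Longrightarrow> a i j x > 0"
    and exc: "sup_norm (a i j) * Z (t - int i) j \<omega> > u"
  shows "sup_norm (cm3 a Z t \<omega>) > ereal u"
proof -
  obtain x where x: "x \<in> unit_cube" "sup_norm (a i j) = \<bar>a i j x\<bar>"
    using sup_norm_attained[OF cont] by metis
  have "ereal u < ereal (a i j x * Z (t - int i) j \<omega>)"
    using exc x pos[OF x(1)] by simp
  also have "\<dots> \<le> cm3 a Z t \<omega> x"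
    unfolding cm3_def by (meson SUP_upper UNIV_I order_trans)
  also have "\<dots> \<le> \<bar>cm3 a Z t \<omega> x\<bar>"
    by (cases "cm3 a Z t \<omega> x") auto
  also have "\<dots> \<le> sup_norm (cm3 a Z t \<omega>)"
    unfolding sup_norm_def by (intro SUP_upper x)
  finally show ?thesis .
qed

text \<open>Nonnegative innovations make the process nonnegative, which removes the absolute value; and
  replacing \<open>a i j x\<close> by its maximum can then only increase a term.\<close>

lemma sup_norm_cm3_exceeds_imp_single_term_exceeds:
  fixes a :: "nat \<Rightarrow> int \<Rightarrow> real ^ 'q::finite \<Rightarrow> real"
  assumes cont: "\<And>i j. continuous_on unit_cube (a i j)"
    and pos: "\<And>i j x. x \<in> unit_cube \<Longrightarrow> a i j x > 0"
    and Z: "\<And>s j. Z s j \<omega> \<ge> 0"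
    and exc: "sup_norm (cm3 a Z t \<omega>) > ereal u"
  shows "\<exists>j i. sup_norm (a i j) * Z (t - int i) j \<omega> > u"
proof -
  obtain x where x: "x \<in> unit_cube" "ereal u < \<bar>cm3 a Z t \<omega> x\<bar>"
    using exc unfolding sup_norm_def less_SUP_iff by blast
  have "0 \<le> ereal (a 0 0 x * Z (t - int 0) 0 \<omega>)"
    using Z pos[OF x(1)] by (simp add: less_imp_le)
  also have "\<dots> \<le> cm3 a Z t \<omega> x"
    unfolding cm3_def by (meson SUP_upper UNIV_I order_trans)
  finally have "ereal u < cm3 a Z t \<omega> x"
    using x(2) by simp
  then obtain j i where ji: "u < a i j x * Z (t - int i) j \<omega>"
    unfolding cm3_def less_SUP_iff by auto
  obtain y where "sup_norm (a i j) = \<bar>a i j y\<bar>" "\<And>y'. y' \<in> unit_cube \<Longrightarrow> \<bar>a i j y'\<bar> \<le> \<bar>a i j y\<bar>"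
    using sup_norm_attained[OF cont[of i j]] by metis
  then have "a i j x \<le> sup_norm (a i j)"
    using x(1) by force
  then have "a i j x * Z (t - int i) j \<omega> \<le> sup_norm (a i j) * Z (t - int i) j \<omega>"
    by (intro mult_right_mono Z)
  with ji have "sup_norm (a i j) * Z (t - int i) j \<omega> > u" by linarith
  then show ?thesis by blast
qed

section \<open>The overlap of the weights at distant lags\<close>

text \<open>An innovation that carries the weight \<open>c (j, i)\<close> at time \<open>0\<close> carries the weight \<open>c (j, i + t)\<close> at
  time \<open>t\<close>. The overlap is the supremal weight with which it can count both at time \<open>0\<close> and at some
  time at distance at least \<open>m\<close>.\<close>

definition distant_overlap :: "(int \<times> nat \<Rightarrow> real) \<Rightarrow> int \<Rightarrow> int \<times> nat \<Rightarrow> real" where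
  "distant_overlap c m = (\<lambda>(j, i). min (c (j, i)) (SUP k\<in>{k. m \<le> \<bar>int k - int i\<bar>}. c (j, k)))"

lemma
  fixes c :: "int \<times> nat \<Rightarrow> real"
  assumes int: "integrable (count_space UNIV) c"
  shows row_bdd_above: "bdd_above ((\<lambda>k. c (j, k)) ` K)"
    and row_tendsto_0: "(\<lambda>k. c (j, k)) \<longlonglongrightarrow> 0"
proof -
  have "c summable_on UNIV"
    using int by (simp add: integrable_count_space_iff_summable_on)
  then have "c summable_on range (Pair j)"
    by (rule summable_on_subset_banach) auto
  then have "(c \<circ> Pair j) summable_on (UNIV :: nat set)"
    by (subst (asm) summable_on_reindex) (auto simp: inj_on_def)
  then have "summable (\<lambda>k. c (j, k))"
    by (simp add: o_def summable_on_imp_summable)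
  then show lim: "(\<lambda>k. c (j, k)) \<longlonglongrightarrow> 0"
    by (rule summable_LIMSEQ_zero)
  then have "bdd_above (range (\<lambda>k. c (j, k)))"
    by (meson Bseq_eq_bounded bounded_imp_bdd_above convergentI convergent_imp_Bseq)
  then show "bdd_above ((\<lambda>k. c (j, k)) ` K)"
    by (rule bdd_above_mono) auto
qed

lemma distant_indices_nonempty: "{k. m \<le> \<bar>int k - int i\<bar>} \<noteq> {}"
proof -
  have "m \<le> \<bar>int (i + nat m) - int i\<bar>" by simp
  then show ?thesis by blast
qed

text \<open>For fixed \<open>(j, i)\<close> the overlap vanishes as \<open>m\<close> grows, since \<open>\<bar>k - i\<bar> \<ge> m\<close> forces \<open>k\<close> to
  infinity and the row \<open>c (j, k)\<close> is summable; the bound by \<open>c\<close> lets the limit pass through the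
  sum.\<close>

lemma
  fixes c :: "int \<times> nat \<Rightarrow> real"
  assumes int: "integrable (count_space UNIV) c"
    and pos: "\<And>p. c p > 0"
  shows distant_overlap_pos: "distant_overlap c m p > 0"
    and distant_overlap_le: "distant_overlap c m p \<le> c p"
    and distant_overlap_integrable: "integrable (count_space UNIV) (distant_overlap c m)"
    and integral_distant_overlap_tendsto_0: "((\<lambda>m. \<integral>p. distant_overlap c m p \<partial>count_space UNIV) \<longlongrightarrow> 0) at_top"
proof -
  show gt: "distant_overlap c m p > 0" for m p
  proof -
    obtain j i where p: "p = (j, i)" by force
    obtain k where k: "k \<in> {k. m \<le> \<bar>int k - int i\<bar>}"
      using distant_indices_nonempty[of m i] by blast
    have "0 < c (j, k)" by (rule pos)
    also have "\<dots> \<le> (SUP k\<in>{k. m \<le> \<bar>int k - int i\<bar>}. c (j, k))"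
      by (rule cSUP_upper[OF k row_bdd_above[OF int]])
    finally show ?thesis by (simp add: p distant_overlap_def pos)
  qed
  show le: "distant_overlap c m p \<le> c p" for m p
    by (cases p) (simp add: distant_overlap_def)
  show "integrable (count_space UNIV) (distant_overlap c m)" for m
    by (rule Bochner_Integration.integrable_bound[OF int])
       (use gt le in \<open>auto simp: abs_of_pos pos\<close>)
  have "((\<lambda>m. distant_overlap c m p) \<longlongrightarrow> 0) at_top" for p
  proof -
    obtain j i where p: "p = (j, i)" by force
    show ?thesis
    proof (rule tendstoI)
      fix e :: real assume "e > 0"
      then have "eventually (\<lambda>k. c (j, k) < e / 2) sequentially"
        using row_tendsto_0[OF int, of j] by (intro order_tendstoD) auto
      then obtain K where K: "\<And>k. k \<ge> K \<Longrightarrow> c (j, k) < e / 2"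
        by (auto simp: eventually_sequentially)
      show "\<forall>\<^sub>F m in at_top. dist (distant_overlap c m p) 0 < e"
        using eventually_ge_at_top[of "int K + int i + 1"]
      proof eventually_elim
        case (elim m)
        have "(SUP k\<in>{k. m \<le> \<bar>int k - int i\<bar>}. c (j, k)) \<le> e / 2"
        proof (rule cSUP_least[OF distant_indices_nonempty])
          fix k assume "k \<in> {k. m \<le> \<bar>int k - int i\<bar>}"
          with elim have "k \<ge> K" by auto
          then show "c (j, k) \<le> e / 2" using K[of k] by simp
        qed
        then have "distant_overlap c m p < e"
          using \<open>e > 0\<close> by (simp add: p distant_overlap_def)
        with gt[of m p] show ?case by simp
      qed
    qed
  qed
  \<comment> \<open>Dominated convergence is a statement about sequences, whence the detour from \<open>int\<close> through
    \<open>nat\<close>.\<close>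
  then have "(\<lambda>n. distant_overlap c (int n) p) \<longlonglongrightarrow> 0" for p
    by (rule filterlim_compose) (rule filterlim_int_sequentially)
  then have "(\<lambda>n. \<integral>p. distant_overlap c (int n) p \<partial>count_space UNIV) \<longlonglongrightarrow>
      (\<integral>p. 0 \<partial>count_space (UNIV :: (int \<times> nat) set))"
    by (intro integral_dominated_convergence[where w = c] int)
       (use gt le in \<open>auto simp: abs_of_pos\<close>)
  from filterlim_compose[OF this filterlim_nat_sequentially]
  have "((\<lambda>m. \<integral>p. distant_overlap c (int (nat m)) p \<partial>count_space UNIV) \<longlongrightarrow> 0) at_top"
    by simp
  then show "((\<lambda>m. \<integral>p. distant_overlap c m p \<partial>count_space UNIV) \<longlongrightarrow> 0) at_top"
    by (rule Lim_transform_eventually) (use eventually_ge_at_top[of "0 :: int"] in eventually_elim, simp)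
qed

section \<open>Joint exceedances\<close>

text \<open>The first summand accounts for one innovation that causes both exceedances, the second one for
  two different and hence independent innovations. The same-innovation part is not split according to
  \<open>t\<close>, so that only the second summand grows with the number of times.\<close>

lemma (in prob_space) joint_exceedance_le:
  fixes c :: "int \<times> nat \<Rightarrow> real" and Z :: "int \<Rightarrow> int \<Rightarrow> 'a \<Rightarrow> real"
  assumes indep: "indep_vars (\<lambda>_. borel) (\<lambda>(s, j). Z s j) UNIV"
    and frechet: "\<And>s j. unit_frechet M (Z s j)"
    and int: "integrable (count_space UNIV) c" and pos: "\<And>p. c p > 0"
    and u: "u > 0" and T: "finite T" "\<And>t. t \<in> T \<Longrightarrow> m \<le> \<bar>t\<bar>"
  shows "prob {\<omega> \<in> space M. (\<exists>t\<in>T. \<exists>j i. c (j, i) * Z (t - int i) j \<omega> > u) \<and>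
        (\<exists>j i. c (j, i) * Z (0 - int i) j \<omega> > u)}
      \<le> (\<integral>p. distant_overlap c m p \<partial>count_space UNIV) / u
        + real (card T) * ((\<integral>p. c p \<partial>count_space UNIV) / u)\<^sup>2"
    (is "prob ?J \<le> ?D / u + _ * (?C / u)\<^sup>2")
proof -
  have [measurable]: "Z s j \<in> borel_measurable M" for s j
    using frechet by (simp add: unit_frechet_def)
  define H where "H t p = {\<omega> \<in> space M. c p * Z (t - int (snd p)) (fst p) \<omega> > u}" for t p
  \<comment> \<open>The innovation in term \<open>(j, i)\<close> at time \<open>t\<close> is indexed by \<open>(t - i, j)\<close>; \<open>diff\<close> is empty when the
    two innovations coincide, which leaves these cases to \<open>same\<close>.\<close>
  define same where "same p = {\<omega> \<in> space M. distant_overlap c m p * Z (- int (snd p)) (fst p) \<omega> > u}" for p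
  define diff where "diff t p q =
    (if (- int (snd p), fst p) = (t - int (snd q), fst q) then {} else H 0 p \<inter> H t q)" for t p q
  have [measurable]: "H t p \<in> sets M" "same p \<in> sets M" for t p
    unfolding H_def same_def by measurable
  have [measurable]: "diff t p q \<in> sets M" for t p q
    unfolding diff_def by auto
  have D0: "?D \<ge> 0" and C0: "?C \<ge> 0"
    using distant_overlap_pos[OF int pos] pos by (auto intro!: integral_nonneg_AE simp: less_imp_le)

  have "?J \<subseteq> (\<Union>p. same p) \<union> (\<Union>p. \<Union>t\<in>T. \<Union>q. diff t p q)"
  proof
    fix \<omega> assume "\<omega> \<in> ?J"
    then obtain t j i k l where \<omega>: "\<omega> \<in> space M" and t: "t \<in> T"
      and kl: "c (k, l) * Z (t - int l) k \<omega> > u" and ji: "c (j, i) * Z (0 - int i) j \<omega> > u"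
      by blast
    show "\<omega> \<in> (\<Union>p. same p) \<union> (\<Union>p. \<Union>t\<in>T. \<Union>q. diff t p q)"
    proof (cases "(- int i, j) = (t - int l, k)")
      case True
      then have lt: "int l - int i = t" and k: "k = j" by auto
      have Z0: "Z (- int i) j \<omega> > 0"
        using ji u pos[of "(j, i)"] zero_less_mult_pos[of "c (j, i)" "Z (- int i) j \<omega>"] by simp
      have "c (j, l) \<le> (SUP k\<in>{k. m \<le> \<bar>int k - int i\<bar>}. c (j, k))"
        using T(2)[OF t] lt by (intro cSUP_upper row_bdd_above[OF int]) auto
      then have "min (c (j, i)) (c (j, l)) \<le> distant_overlap c m (j, i)"
        by (auto simp: distant_overlap_def)
      then have "min (c (j, i)) (c (j, l)) * Z (- int i) j \<omega> \<le> distant_overlap c m (j, i) * Z (- int i) j \<omega>"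
        using Z0 by (intro mult_right_mono) auto
      moreover have "u < min (c (j, i)) (c (j, l)) * Z (- int i) j \<omega>"
        using ji kl True by (auto simp: min_def)
      ultimately have "\<omega> \<in> same (j, i)"
        using \<omega> by (simp add: same_def)
      then show ?thesis by blast
    next
      case False
      then have "\<omega> \<in> diff t (j, i) (k, l)"
        using \<omega> kl ji by (auto simp: diff_def H_def)
      then show ?thesis using t by blast
    qed
  qed
  then have "emeasure M ?J \<le> emeasure M ((\<Union>p. same p) \<union> (\<Union>p. \<Union>t\<in>T. \<Union>q. diff t p q))"
    using T(1) by (intro emeasure_mono) auto
  also have "\<dots> \<le> emeasure M (\<Union>p. same p) + emeasure M (\<Union>p. \<Union>t\<in>T. \<Union>q. diff t p q)"
    using T(1) by (intro emeasure_subadditive) auto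
  also have "\<dots> \<le> ennreal (?D / u) + ennreal (real (card T) * (?C / u)\<^sup>2)"
  proof (rule add_mono)
    have "emeasure M (\<Union>p. same p) \<le> (\<integral>\<^sup>+p. emeasure M (same p) \<partial>count_space UNIV)"
      by (rule emeasure_UN_le_nn_integral_count_space) simp
    also have "\<dots> \<le> (\<integral>\<^sup>+p. ennreal (distant_overlap c m p / u) \<partial>count_space UNIV)"
      using unit_frechet_tail_le[OF frechet distant_overlap_pos[OF int pos] u]
      by (intro nn_integral_mono) (auto simp: same_def emeasure_eq_measure intro!: ennreal_leI)
    also have "\<dots> = ennreal (\<integral>p. distant_overlap c m p / u \<partial>count_space UNIV)"
      using distant_overlap_pos[OF int pos] u
      by (intro nn_integral_eq_integral integrable_divide distant_overlap_integrable[OF int pos])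
         (auto simp: less_imp_le)
    finally show "emeasure M (\<Union>p. same p) \<le> ennreal (?D / u)" by simp
  next
    have H_le: "prob (H t p) \<le> c p / u" for t p
      unfolding H_def by (rule unit_frechet_tail_le[OF frechet pos u])
    have diff_le: "emeasure M (diff t p q) \<le> ennreal (c p / u) * ennreal (c q / u)" for t p q
    proof (cases "(- int (snd p), fst p) = (t - int (snd q), fst q)")
      case False
      have "H 0 p \<inter> H t q =
          (\<lambda>(s, j). Z s j) (- int (snd p), fst p) -` {x. c p * x > u} \<inter>
          (\<lambda>(s, j). Z s j) (t - int (snd q), fst q) -` {x. c q * x > u} \<inter> space M"
        by (auto simp: H_def)
      then have "prob (H 0 p \<inter> H t q) =
          prob ((\<lambda>(s, j). Z s j) (- int (snd p), fst p) -` {x. c p * x > u} \<inter> space M) *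
          prob ((\<lambda>(s, j). Z s j) (t - int (snd q), fst q) -` {x. c q * x > u} \<inter> space M)"
        using indep_vars_prob_pair[OF indep False, of "{x. c p * x > u}" "{x. c q * x > u}"] by simp
      also have "\<dots> = prob (H 0 p) * prob (H t q)"
        by (intro arg_cong2[of _ _ _ _ "(*)"] arg_cong[of _ _ prob]) (auto simp: H_def)
      also have "\<dots> \<le> (c p / u) * (c q / u)"
        using H_le pos u by (intro mult_mono) (auto simp: less_imp_le)
      finally show ?thesis
        using False pos[of p] pos[of q] u
        by (simp add: diff_def emeasure_eq_measure ennreal_mult'[symmetric] ennreal_leI)
    qed (simp add: diff_def)
    have C: "(\<integral>\<^sup>+p. ennreal (c p / u) \<partial>count_space UNIV) = ennreal (?C / u)"
      using pos u int by (subst nn_integral_eq_integral) (auto simp: less_imp_le)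
    have "emeasure M (\<Union>p. \<Union>t\<in>T. \<Union>q. diff t p q)
        \<le> (\<integral>\<^sup>+p. emeasure M (\<Union>t\<in>T. \<Union>q. diff t p q) \<partial>count_space UNIV)"
      using T(1) by (intro emeasure_UN_le_nn_integral_count_space) auto
    also have "\<dots> \<le> (\<integral>\<^sup>+p. (\<Sum>t\<in>T. emeasure M (\<Union>q. diff t p q)) \<partial>count_space UNIV)"
      using T(1) by (intro nn_integral_mono emeasure_subadditive_finite) auto
    also have "\<dots> \<le> (\<integral>\<^sup>+p. (\<Sum>t\<in>T. \<integral>\<^sup>+q. emeasure M (diff t p q) \<partial>count_space UNIV) \<partial>count_space UNIV)"
      by (intro nn_integral_mono sum_mono emeasure_UN_le_nn_integral_count_space) auto
    also have "\<dots> \<le> (\<integral>\<^sup>+p. (\<Sum>t\<in>T. \<integral>\<^sup>+q. ennreal (c p / u) * ennreal (c q / u)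
        \<partial>count_space UNIV) \<partial>count_space UNIV)"
      by (intro nn_integral_mono sum_mono diff_le)
    also have "\<dots> = (\<integral>\<^sup>+p. ennreal (c p / u) * (of_nat (card T) * ennreal (?C / u)) \<partial>count_space UNIV)"
      by (simp add: nn_integral_cmult C ac_simps)
    also have "\<dots> = ennreal (?C / u) * (of_nat (card T) * ennreal (?C / u))"
      by (simp add: nn_integral_multc C)
    also have "\<dots> = ennreal (real (card T) * (?C / u)\<^sup>2)"
      using C0 u by (simp add: ennreal_of_nat_eq_real_of_nat ennreal_mult'[symmetric] power2_eq_square ac_simps)
    finally show "emeasure M (\<Union>p. \<Union>t\<in>T. \<Union>q. diff t p q) \<le> ennreal (real (card T) * (?C / u)\<^sup>2)" .
  qed
  also have "\<dots> = ennreal (?D / u + real (card T) * (?C / u)\<^sup>2)"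
    using D0 u by (subst ennreal_plus) auto
  finally show ?thesis
    using D0 u by (simp add: emeasure_eq_measure ennreal_le_iff del: ennreal_plus)
qed

text \<open>The bound holds without settling whether the two events, given by uncountable suprema over the
  cube, are measurable: if the joint event is not measurable, its
  \<open>measure\<close> is \<open>0\<close>, and otherwise it lies in a measurable event up to a null set; if the conditioning
  event is not measurable, the conditional probability is a division by \<open>0\<close>, hence \<open>0\<close>, and otherwise
  its probability is bounded below by that of an exceedance of the innovation at \<open>(0, 0)\<close>.\<close>

lemma (in prob_space) cond_prob_cluster_le:
  fixes a :: "nat \<Rightarrow> int \<Rightarrow> real ^ 'q::finite \<Rightarrow> real"
    and Z :: "int \<Rightarrow> int \<Rightarrow> 'a \<Rightarrow> real"
    and c :: "int \<times> nat \<Rightarrow> real"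
  assumes cont: "\<And>i j. continuous_on unit_cube (a i j)"
    and a_pos: "\<And>i j x. x \<in> unit_cube \<Longrightarrow> a i j x > 0"
    and indep: "indep_vars (\<lambda>_. borel) (\<lambda>(s, j). Z s j) UNIV"
    and frechet: "\<And>s j. unit_frechet M (Z s j)"
    and c: "\<And>i j. c (j, i) = sup_norm (a i j)"
    and int: "integrable (count_space UNIV) c" and pos: "\<And>p. c p > 0"
    and u: "u > 0" and T: "finite T" "\<And>t. t \<in> T \<Longrightarrow> m \<le> \<bar>t\<bar>"
  shows "\<P>(\<omega> in M. (SUP t\<in>T. sup_norm (cm3 a Z t \<omega>)) > ereal u \<bar> sup_norm (cm3 a Z 0 \<omega>) > ereal u)
      \<le> ((\<integral>p. distant_overlap c m p \<partial>count_space UNIV) / u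
        + real (card T) * ((\<integral>p. c p \<partial>count_space UNIV) / u)\<^sup>2) / (1 - exp (- c (0, 0) / u))"
    (is "cond_prob M ?P ?Q \<le> ?B / ?A")
proof -
  have [measurable]: "Z s j \<in> borel_measurable M" for s j
    using frechet by (simp add: unit_frechet_def)
  define J where "J = {\<omega> \<in> space M. (\<exists>t\<in>T. \<exists>j i. c (j, i) * Z (t - int i) j \<omega> > u) \<and>
        (\<exists>j i. c (j, i) * Z (0 - int i) j \<omega> > u)}"
  have [measurable]: "J \<in> sets M"
    using T(1) unfolding J_def by measurable
  have J_le: "prob J \<le> ?B"
    unfolding J_def by (rule joint_exceedance_le[OF indep frechet int pos u T])
  then have B0: "?B \<ge> 0" using measure_nonneg order_trans by blast
  have "AE \<omega> in M. \<forall>s j. Z s j \<omega> \<ge> 0"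
    using unit_frechet_AE_nonneg[OF frechet] by (simp add: AE_all_countable)
  then obtain N where N: "{\<omega> \<in> space M. \<not> (\<forall>s j. Z s j \<omega> \<ge> 0)} \<subseteq> N" "N \<in> sets M" "emeasure M N = 0"
    by (rule AE_E)
  have "{\<omega> \<in> space M. ?P \<omega> \<and> ?Q \<omega>} \<subseteq> J \<union> N"
  proof
    fix \<omega> assume \<omega>: "\<omega> \<in> {\<omega> \<in> space M. ?P \<omega> \<and> ?Q \<omega>}"
    show "\<omega> \<in> J \<union> N"
    proof (cases "\<forall>s j. Z s j \<omega> \<ge> 0")
      case True
      then have *: "\<exists>j i. c (j, i) * Z (t - int i) j \<omega> > u" if "sup_norm (cm3 a Z t \<omega>) > ereal u" for t
        unfolding c using sup_norm_cm3_exceeds_imp_single_term_exceeds[OF cont a_pos _ that] by blast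
      from \<omega> obtain t where "t \<in> T" "sup_norm (cm3 a Z t \<omega>) > ereal u"
        unfolding less_SUP_iff by blast
      with \<omega> * show ?thesis unfolding J_def by blast
    qed (use \<omega> N(1) in blast)
  qed
  then have "prob {\<omega> \<in> space M. ?P \<omega> \<and> ?Q \<omega>} \<le> prob (J \<union> N)"
    using N(2) by (intro finite_measure_mono) auto
  also have "\<dots> \<le> prob J + prob N"
    using N(2) by (rule measure_Un_le[OF \<open>J \<in> sets M\<close>])
  also have "prob N = 0"
    using N(3) by (simp add: measure_def)
  finally have num: "prob {\<omega> \<in> space M. ?P \<omega> \<and> ?Q \<omega>} \<le> ?B"
    using J_le by simp
  have A0: "?A > 0" using pos[of "(0, 0)"] u by simp
  show ?thesis
  proof (cases "{\<omega> \<in> space M. ?Q \<omega>} \<in> sets M")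
    case True
    have "?A = prob {\<omega> \<in> space M. c (0, 0) * Z 0 0 \<omega> > u}"
      by (rule unit_frechet_tail[OF frechet pos u, symmetric])
    also have "\<dots> \<le> prob {\<omega> \<in> space M. ?Q \<omega>}"
      using single_term_exceeds_imp_sup_norm_cm3_exceeds[OF cont a_pos, where t = 0 and i = 0 and j = 0] True
      by (intro finite_measure_mono) (auto simp: c)
    finally show ?thesis
      unfolding cond_prob_def using num B0 A0 by (intro frac_le) auto
  next
    case False
    then have "cond_prob M ?P ?Q = 0"
      by (simp add: cond_prob_def measure_notin_sets)
    then show ?thesis using B0 A0 by simp
  qed
qed

section \<open>The limit along the window lengths\<close>

lemma finite_abs_interval: "finite {t::int. m \<le> \<bar>t\<bar> \<and> \<bar>t\<bar> \<le> int r}"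
  and card_abs_interval_le: "card {t::int. m \<le> \<bar>t\<bar> \<and> \<bar>t\<bar> \<le> int r} \<le> 2 * r + 1"
proof -
  have sub: "{t::int. m \<le> \<bar>t\<bar> \<and> \<bar>t\<bar> \<le> int r} \<subseteq> {- int r..int r}" by auto
  then show "finite {t::int. m \<le> \<bar>t\<bar> \<and> \<bar>t\<bar> \<le> int r}"
    by (rule finite_subset) simp
  show "card {t::int. m \<le> \<bar>t\<bar> \<and> \<bar>t\<bar> \<le> int r} \<le> 2 * r + 1"
    using card_mono[OF _ sub] by simp
qed

text \<open>Both numerator and denominator are of order \<open>1 / n\<close>; after multiplication by \<open>n\<close> the
  denominator tends to \<open>c\<close>, and the term that comes from different innovations becomes
  \<open>(2 r n + 1) / n * C\<^sup>2\<close>, which vanishes.\<close>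

lemma cluster_bound_tendsto:
  fixes r :: "nat \<Rightarrow> nat"
  assumes r: "(\<lambda>n. real (r n) / real n) \<longlonglongrightarrow> 0" and "c > 0"
  shows "(\<lambda>n. (D / real n + real (2 * r n + 1) * (C / real n)\<^sup>2) / (1 - exp (- c / real n)))
    \<longlonglongrightarrow> D / c"
proof -
  have "(\<lambda>n. (D + (2 * (real (r n) / real n) + 1 / real n) * C\<^sup>2) / (real n * (1 - exp (- c / real n))))
      \<longlonglongrightarrow> (D + (2 * 0 + 0) * C\<^sup>2) / c"
  proof -
    have "(\<lambda>n. 1 / real n) \<longlonglongrightarrow> 0" by real_asymp
    moreover have "(\<lambda>n. real n * (1 - exp (- c / real n))) \<longlonglongrightarrow> c"
      using \<open>c > 0\<close> by real_asymp
    ultimately show ?thesis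
      using r \<open>c > 0\<close>
      by (intro tendsto_divide tendsto_add tendsto_mult tendsto_const) auto
  qed
  then have "(\<lambda>n. (D + (2 * (real (r n) / real n) + 1 / real n) * C\<^sup>2) / (real n * (1 - exp (- c / real n))))
      \<longlonglongrightarrow> D / c" by simp
  then show ?thesis
  proof (rule Lim_transform_eventually)
    show "\<forall>\<^sub>F n in sequentially.
      (D + (2 * (real (r n) / real n) + 1 / real n) * C\<^sup>2) / (real n * (1 - exp (- c / real n))) =
      (D / real n + real (2 * r n + 1) * (C / real n)\<^sup>2) / (1 - exp (- c / real n))"
      using eventually_gt_at_top[of 0]
    proof eventually_elim
      case (elim n)
      then have "(D + (2 * (real (r n) / real n) + 1 / real n) * C\<^sup>2) =
          real n * (D / real n + real (2 * r n + 1) * (C / real n)\<^sup>2)"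
        by (simp add: field_simps power2_eq_square)
      then show ?case using elim by simp
    qed
  qed
qed

theorem theorem2p4:
  fixes M :: "'w measure"
    and a :: "nat \<Rightarrow> int \<Rightarrow> real ^ 'q::finite \<Rightarrow> real"
    and Z :: "int \<Rightarrow> int \<Rightarrow> 'w \<Rightarrow> real"
  assumes "prob_space M"
    and "\<And>i j. continuous_on unit_cube (a i j)"
    and "\<And>i j x. x \<in> unit_cube \<Longrightarrow> a i j x > 0"
    and "prob_space.indep_vars M (\<lambda>_. borel) (\<lambda>(s, j). Z s j) UNIV"
    and "\<And>s j. unit_frechet M (Z s j)"
    and "(\<lambda>(j, i). sup_norm (a i j)) summable_on (UNIV :: (int \<times> nat) set)"
  shows "finite_cluster_condition M (cm3 a Z)"
proof -
  interpret prob_space M by fact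
  define c :: "int \<times> nat \<Rightarrow> real" where "c = (\<lambda>(j, i). sup_norm (a i j))"
  have pos: "c p > 0" for p
  proof -
    obtain j i where p: "p = (j, i)" by force
    obtain x where "x \<in> unit_cube" "sup_norm (a i j) = \<bar>a i j x\<bar>"
      using sup_norm_attained[OF assms(2)] by metis
    then show ?thesis using assms(3)[of x i j] by (simp add: p c_def)
  qed
  have int: "integrable (count_space UNIV) c"
    using assms(6) unfolding c_def[symmetric] by (simp add: integrable_count_space_iff_summable_on)
  define D where "D m = (\<integral>p. distant_overlap c m p \<partial>count_space UNIV)" for m
  define C where "C = (\<integral>p. c p \<partial>count_space UNIV)"
  define r :: "nat \<Rightarrow> nat" where "r n = nat \<lfloor>sqrt (real n)\<rfloor> + 1" for n
  have r_top: "filterlim r at_top sequentially"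
    unfolding r_def by real_asymp
  have r_o: "(\<lambda>n. real (r n) / real n) \<longlonglongrightarrow> 0"
    unfolding r_def by real_asymp
  define p where "p m n =
    \<P>(\<omega> in M. (SUP t\<in>{t. m \<le> \<bar>t\<bar> \<and> \<bar>t\<bar> \<le> int (r n)}. sup_norm (cm3 a Z t \<omega>)) > ereal (real n)
      \<bar> sup_norm (cm3 a Z 0 \<omega>) > ereal (real n))" for m n
  have p_nonneg: "p m n \<ge> 0" for m n
    by (simp add: p_def cond_prob_def)
  have p_le: "p m n \<le> (D m / real n + real (2 * r n + 1) * (C / real n)\<^sup>2) / (1 - exp (- c (0, 0) / real n))"
    if "n > 0" for m n
  proof -
    let ?T = "{t. m \<le> \<bar>t\<bar> \<and> \<bar>t\<bar> \<le> int (r n)}"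
    have "p m n \<le> (D m / real n + real (card ?T) * (C / real n)\<^sup>2) / (1 - exp (- c (0, 0) / real n))"
      unfolding p_def D_def C_def using that
      by (intro cond_prob_cluster_le assms finite_abs_interval int pos) (auto simp: c_def)
    also have "\<dots> \<le> (D m / real n + real (2 * r n + 1) * (C / real n)\<^sup>2) / (1 - exp (- c (0, 0) / real n))"
      using pos[of "(0, 0)"] that card_abs_interval_le[of m "r n"]
      by (intro divide_right_mono add_left_mono mult_right_mono) (auto simp del: of_nat_add of_nat_mult)
    finally show ?thesis .
  qed
  have limsup_le: "limsup (\<lambda>n. ereal (p m n)) \<le> ereal (D m / c (0, 0))" for m
  proof -
    have "limsup (\<lambda>n. ereal (p m n)) \<le> limsup (\<lambda>n. ereal
        ((D m / real n + real (2 * r n + 1) * (C / real n)\<^sup>2) / (1 - exp (- c (0, 0) / real n))))"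
      by (rule Limsup_mono) (use eventually_gt_at_top[of 0] in eventually_elim, simp only: ereal_less_eq p_le)
    also have "\<dots> = ereal (D m / c (0, 0))"
      using cluster_bound_tendsto[OF r_o pos] by (intro lim_imp_Limsup) auto
    finally show ?thesis .
  qed
  have limsup_ge: "0 \<le> limsup (\<lambda>n. ereal (p m n))" for m
    by (rule le_Limsup) (auto simp: p_nonneg)
  have "((\<lambda>m. ereal (D m / c (0, 0))) \<longlongrightarrow> ereal (0 / c (0, 0))) at_top"
    using integral_distant_overlap_tendsto_0[OF int pos] pos[of "(0, 0)"] unfolding D_def
    by (intro tendsto_ereal tendsto_divide tendsto_const) auto
  then have D_lim: "((\<lambda>m. ereal (D m / c (0, 0))) \<longlongrightarrow> 0) at_top"
    by (simp add: zero_ereal_def)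
  have "((\<lambda>m. limsup (\<lambda>n. ereal (p m n))) \<longlongrightarrow> 0) at_top"
    by (rule tendsto_sandwich[OF _ _ tendsto_const D_lim]) (simp_all add: limsup_le limsup_ge)
  then show ?thesis
    unfolding finite_cluster_condition_def using r_top r_o
    by (intro exI[of _ r]) (auto simp: r_def p_def)
qed

end
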